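(* Suppose that $\mathcal{A} \in T_{m,n}$ is a column competent tensor. Then all principal subtensors of $\mathcal{A}$ are column competent tensors.
   Context: $T_{m,n}$ is the set of real tensors $\mathcal{A}=(a_{i_1 i_2\ldots i_m})$ of order $m$ and dimension $n$ (with $i_1,\ldots,i_m\in[n]=\{1,\ldots,n\}$, $m,n$ positive integers, $m\ge 2$). For $x\in\mathbb{R}^n$, $\mathcal{A}x^{m-1}\in\mathbb{R}^n$ is the vector with $(\mathcal{A}x^{m-1})_i=\sum_{i_2,\ldots,i_m=1}^n a_{i i_2\ldots i_m}x_{i_2}\cdots x_{i_m}$. A tensor $\mathcal{A}\in T_{m,n}$ is column competent if, for $x\in\mathbb{R}^n$, $x_i(\mathcal{A}x^{m-1})_i=0$ for all $i\in[n]$ implies $\mathcal{A}x^{m-1}=0$. For $J\subseteq[n]$ with $|J|=r$, $1\le r\le n$, the principal subtensor of $\mathcal{A}$ indexed by $J$ is the tensor $\mathcal{A}^J_r=(a_{i_1 i_2\ldots i_m})$ with $i_1,\ldots,i_m\in J$, of order $m$ and dimension $r$ (vectors in $\mathbb{R}^r$ being indexed by $J$). *)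

theory Defs
  imports Complex_Main "HOL-Library.FuncSet"
begin

text \<open>
  Tensors and vectors are indexed by an arbitrary finite set of naturals, so that a principal
  subtensor of a tensor over \<open>{1..n}\<close> is a tensor over \<open>J \<subseteq> {1..n}\<close>; its dimension is \<open>card J\<close>.
  Both are extensional functions, i.e. they carry no information outside their index domain.
  A multi-index \<open>(i\<^sub>1, \<dots>, i\<^sub>m)\<close> is the list \<open>[i\<^sub>1, \<dots>, i\<^sub>m]\<close>.
\<close>

definition multi_indices :: "nat \<Rightarrow> nat set \<Rightarrow> nat list set" where
  "multi_indices m I = {is. set is \<subseteq> I \<and> length is = m}"

definition tensors :: "nat \<Rightarrow> nat set \<Rightarrow> (nat list \<Rightarrow> real) set" where
  "tensors m I = multi_indices m I \<rightarrow>\<^sub>E UNIV"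

definition vectors :: "nat set \<Rightarrow> (nat \<Rightarrow> real) set" where
  "vectors I = I \<rightarrow>\<^sub>E UNIV"

definition zero_vector :: "nat set \<Rightarrow> nat \<Rightarrow> real" where
  "zero_vector I = (\<lambda>i\<in>I. 0)"

text \<open>The vector \<open>A x\<^bsup>m-1\<^esup>\<close> for a tensor \<open>A\<close> of order \<open>m \<ge> 1\<close>.\<close>

definition tensor_apply ::
    "nat \<Rightarrow> nat set \<Rightarrow> (nat list \<Rightarrow> real) \<Rightarrow> (nat \<Rightarrow> real) \<Rightarrow> nat \<Rightarrow> real" where
  "tensor_apply m I A x =
     (\<lambda>i\<in>I. \<Sum>js\<in>multi_indices (m - 1) I. A (i # js) * prod_list (map x js))"

definition column_competent :: "nat \<Rightarrow> nat set \<Rightarrow> (nat list \<Rightarrow> real) \<Rightarrow> bool" where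
  "column_competent m I A \<longleftrightarrow>
     (\<forall>x\<in>vectors I. (\<forall>i\<in>I. x i * tensor_apply m I A x i = 0) \<longrightarrow>
        tensor_apply m I A x = zero_vector I)"

definition principal_subtensor ::
    "nat \<Rightarrow> nat set \<Rightarrow> (nat list \<Rightarrow> real) \<Rightarrow> nat list \<Rightarrow> real" where
  "principal_subtensor m J A = restrict A (multi_indices m J)"

end

theory Submission
  imports Defs
begin

text \<open>
  Extend a vector indexed by \<open>J\<close> by zero to \<open>I\<close>. Monomials with an index outside \<open>J\<close> vanish, so on
  \<open>J\<close> the tensor and its principal subtensor act alike, while outside \<open>J\<close> the competence condition
  holds because the extended vector is zero there.
\<close>

text \<open>The abstraction over \<open>I\<close> keeps the result extensional, hence a member of
  \<open>vectors I\<close>: it is 0 on \<open>I - J\<close> but \<open>undefined\<close> outside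
  \<open>I\<close>.\<close>

definition zero_extension :: "nat set \<Rightarrow> nat set \<Rightarrow> (nat \<Rightarrow> real) \<Rightarrow> nat \<Rightarrow> real" where
  "zero_extension I J x = (\<lambda>i\<in>I. if i \<in> J then x i else 0)"

lemma zero_extension_in_vectors: "zero_extension I J x \<in> vectors I"
  by (simp add: zero_extension_def vectors_def)

lemma finite_multi_indices: "finite I \<Longrightarrow> finite (multi_indices m I)"
  unfolding multi_indices_def by (rule finite_lists_length_eq)

lemma principal_subtensor_in_tensors: "principal_subtensor m J A \<in> tensors m J"
  by (simp add: principal_subtensor_def tensors_def)

lemma tensor_apply_zero_extension:
  assumes "m \<ge> 1" "finite I" "J \<subseteq> I" "i \<in> J"
  shows "tensor_apply m I A (zero_extension I J x) i =
         tensor_apply m J (principal_subtensor m J A) x i"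
proof -
  let ?z = "zero_extension I J x"
  have "(\<Sum>js\<in>multi_indices (m - 1) I. A (i # js) * prod_list (map ?z js)) =
        (\<Sum>js\<in>multi_indices (m - 1) J. principal_subtensor m J A (i # js) * prod_list (map x js))"
  proof (rule sum.mono_neutral_cong_right)
    show "finite (multi_indices (m - 1) I)"
      using assms(2) by (rule finite_multi_indices)
    show "multi_indices (m - 1) J \<subseteq> multi_indices (m - 1) I"
      using assms(3) by (auto simp: multi_indices_def)
    \<comment> \<open>Such a \<open>js\<close> has the right length, so it fails only by having an
      entry in \<open>I - J\<close>, which contributes a zero factor to the product.\<close>
    show "\<forall>js\<in>multi_indices (m - 1) I - multi_indices (m - 1) J.
            A (i # js) * prod_list (map ?z js) = 0"
      by (fastforce simp: multi_indices_def zero_extension_def prod_list_zero_iff)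
  next
    fix js assume js: "js \<in> multi_indices (m - 1) J"
    then have "map ?z js = map x js"
      using assms(3) by (auto simp: multi_indices_def zero_extension_def)
    \<comment> \<open>Here \<open>m \<ge> 1\<close> gives \<open>Suc (m - 1) = m\<close>; membership
      ensures that the restriction returns the entry of \<open>A\<close> and not
      \<open>undefined\<close>.\<close>
    moreover have "i # js \<in> multi_indices m J"
      using js assms(1,4) by (auto simp: multi_indices_def)
    ultimately show "A (i # js) * prod_list (map ?z js) =
        principal_subtensor m J A (i # js) * prod_list (map x js)"
      by (simp only: principal_subtensor_def restrict_apply' simp_thms)
  qed
  with assms(3,4) show ?thesis
    by (auto simp: tensor_apply_def)
qed

lemma column_competent_principal_subtensor:
  assumes "m \<ge> 1" "finite I" "J \<subseteq> I" "column_competent m I A"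
  shows "column_competent m J (principal_subtensor m J A)"
  unfolding column_competent_def
proof (intro ballI impI)
  let ?B = "principal_subtensor m J A"
  fix x assume x: "\<forall>i\<in>J. x i * tensor_apply m J ?B x i = 0"
  let ?z = "zero_extension I J x"
  note apply_eq = tensor_apply_zero_extension[OF assms(1-3)]
  have "?z i * tensor_apply m I A ?z i = 0" if "i \<in> I" for i
  proof (cases "i \<in> J")
    case True
    with x that show ?thesis
      \<comment> \<open>\<open>apply_eq\<close> must rewrite while \<open>?z\<close> is still
        folded; only then is \<open>?z i\<close> evaluated to \<open>x i\<close>.\<close>
      by (simp add: apply_eq) (simp add: zero_extension_def)
  qed (simp add: zero_extension_def that)
  then have "tensor_apply m I A ?z = zero_vector I"
    using assms(4) zero_extension_in_vectors unfolding column_competent_def by blast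
  \<comment> \<open>Since \<open>J \<subseteq> I\<close>, the entry of \<open>zero_vector I\<close>
    at \<open>i\<close> is a true 0, and it transfers back along \<open>apply_eq\<close>.\<close>
  then have "tensor_apply m J ?B x i = 0" if "i \<in> J" for i
    using apply_eq[OF that, of A x] that assms(3) by (auto simp: zero_vector_def)
  then show "tensor_apply m J ?B x = zero_vector J"
    \<comment> \<open>Outside \<open>J\<close> both sides are \<open>undefined\<close>, so agreement
      on \<open>J\<close> gives equality of functions.\<close>
    by (auto simp: fun_eq_iff zero_vector_def tensor_apply_def)
qed

theorem theorem3p1:
  fixes m n :: nat and A :: "nat list \<Rightarrow> real"
  assumes "m \<ge> 2" and "n \<ge> 1"
    and "A \<in> tensors m {1..n}"
    and "column_competent m {1..n} A"
  shows "\<forall>J r. J \<subseteq> {1..n} \<and> card J = r \<and> 1 \<le> r \<and> r \<le> n \<longrightarrow>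
           principal_subtensor m J A \<in> tensors m J \<and>
           column_competent m J (principal_subtensor m J A)"
  using assms(1,4) principal_subtensor_in_tensors
    column_competent_principal_subtensor[of m "{1..n}" _ A] by simp

end
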